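(* Let $n,m,d,s\ge 1$ be integers, let $\mathbf{\Phi}_1,\dots,\mathbf{\Phi}_d\in\mathbb{C}^{n\times m}$ be matrices all of whose columns have unit 2-norm, and define the linear map $\varphi:\mathbb{C}^{m\times d}\to\mathbb{C}^{n\times d}$ by $\varphi(\mathbf{Z})=[\mathbf{\Phi}_1Z_1,\dots,\mathbf{\Phi}_dZ_d]$, where $Z_j$ is the $j$th column of $\mathbf{Z}$. Let $\mathcal{L}$ be a linear map on $\mathbb{C}^{m\times d}$. Let $\mathbf{X}\in\mathbb{C}^{m\times d}$ satisfy $\mathcal{L}\mathbf{X}=0$ ($\mathbf{X}$ is not assumed to be row sparse), let $\mathbf{E}\in\mathbb{C}^{n\times d}$, and put $\mathbf{Y}=\varphi(\mathbf{X})+\mathbf{E}$ and $\varepsilon=\|\mathbf{E}\|_{2,2}$. Suppose that $\varphi$ satisfies the restricted isometry property of order $2s$, $$(1-\delta_{2s})\|\mathbf{Z}\|_{2,2}^2\le\|\varphi(\mathbf{Z})\|_{2,2}^2\le(1+\delta_{2s})\|\mathbf{Z}\|_{2,2}^2\quad\text{for every }2s\text{-row sparse }\mathbf{Z}\in\mathbb{C}^{m\times d},$$ with $\delta_{2s}<\sqrt{2}-1$. Let $\hat{\mathbf{X}}$ be a minimizer of $$\min\|\mathbf{Z}\|_{1,2}\quad\text{subject to}\quad\|\mathbf{Y}-\varphi(\mathbf{Z})\|_{2,2}\le\varepsilon,\quad\mathcal{L}\mathbf{Z}=0 .$$ Then $$\|\hat{\mathbf{X}}-\mathbf{X}\|_{2,2}\le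 C_1s^{-1/2}\|\mathbf{X}-\mathbf{X}^{(s)}\|_{1,2}+C_2\,\varepsilon,$$ where $C_1,C_2$ are constants depending only on $\delta_{2s}$ (and on none of $n,m,d,s,\mathbf{\Phi}_j,\mathcal{L},\mathbf{X},\mathbf{E}$).
   Context: For a matrix $\mathbf{Y}$ with $N$ rows and $a,b\ge1$, $\|\mathbf{Y}\|_{b,a}=\big(\sum_{j=1}^N\|\mathrm{row}_j(\mathbf{Y})\|_a^b\big)^{1/b}$, where $\mathrm{row}_j(\mathbf{Y})$ is the $j$th row of $\mathbf{Y}$ and $\|\cdot\|_a$ is the usual $\ell^a$ norm of a vector. Thus $\|\cdot\|_{2,2}$ is the Frobenius norm and $\|\cdot\|_{1,2}$ is the sum of the Euclidean norms of the rows. A matrix is $k$-row sparse if at most $k$ of its rows are nonzero. $\mathbf{X}^{(s)}$ denotes the matrix obtained from $\mathbf{X}$ by keeping its $s$ rows of largest 2-norm (ties broken arbitrarily) and setting all other rows to zero; it is a best $s$-row sparse approximation of $\mathbf{X}$. *)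

theory Defs
  imports Complex_Main "Jordan_Normal_Form.VS_Connect"
begin

definition lp_norm :: "real \<Rightarrow> complex vec \<Rightarrow> real" where
  "lp_norm a v = (\<Sum>i<dim_vec v. cmod (v $ i) powr a) powr (1 / a)"

text \<open>The norm \<open>\<parallel>Y\<parallel>\<^bsub>b,a\<^esub>\<close>: the outer exponent comes first, the inner one, applied to the rows,
  second.\<close>

definition mixed_norm :: "real \<Rightarrow> real \<Rightarrow> complex mat \<Rightarrow> real" where
  "mixed_norm b a Y = (\<Sum>j<dim_row Y. lp_norm a (row Y j) powr b) powr (1 / b)"

definition row_sparse :: "nat \<Rightarrow> complex mat \<Rightarrow> bool" where
  "row_sparse k Z \<longleftrightarrow> card {j. j < dim_row Z \<and> row Z j \<noteq> 0\<^sub>v (dim_col Z)} \<le> k"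

definition keep_rows :: "nat set \<Rightarrow> complex mat \<Rightarrow> complex mat" where
  "keep_rows S X = mat (dim_row X) (dim_col X) (\<lambda>(i, j). if i \<in> S then X $$ (i, j) else 0)"

text \<open>A relation rather than a function, so that it covers every way of breaking ties.  If \<open>X\<close> has
  fewer than \<open>s\<close> rows, all of them are kept.\<close>

definition is_best_row_approx :: "nat \<Rightarrow> complex mat \<Rightarrow> complex mat \<Rightarrow> bool" where
  "is_best_row_approx s X Xs \<longleftrightarrow>
     (\<exists>S \<subseteq> {..<dim_row X}.
        card S = min s (dim_row X) \<and>
        (\<forall>i\<in>S. \<forall>j\<in>{..<dim_row X} - S. lp_norm 2 (row X j) \<le> lp_norm 2 (row X i)) \<and>
        Xs = keep_rows S X)"

definition columnwise_map :: "nat \<Rightarrow> nat \<Rightarrow> (nat \<Rightarrow> complex mat) \<Rightarrow> complex mat \<Rightarrow> complex mat" where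
  "columnwise_map n d \<Phi> Z = mat_of_cols n (map (\<lambda>j. \<Phi> j *\<^sub>v col Z j) [0..<d])"

definition row_sparse_RIP ::
    "nat \<Rightarrow> nat \<Rightarrow> (complex mat \<Rightarrow> complex mat) \<Rightarrow> nat \<Rightarrow> real \<Rightarrow> bool" where
  "row_sparse_RIP m d \<phi> k \<delta> \<longleftrightarrow>
     (\<forall>Z \<in> carrier_mat m d. row_sparse k Z \<longrightarrow>
        (1 - \<delta>) * (mixed_norm 2 2 Z)\<^sup>2 \<le> (mixed_norm 2 2 (\<phi> Z))\<^sup>2 \<and>
        (mixed_norm 2 2 (\<phi> Z))\<^sup>2 \<le> (1 + \<delta>) * (mixed_norm 2 2 Z)\<^sup>2)"

text \<open>Linearity between spaces of complex matrices is the library's locale \<open>linear_map\<close>.  With these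
  matrix modules it has the expected meaning: the vector space axioms it includes hold.\<close>

lemma linear_map_mat_iff:
  "linear_map class_ring (module_mat TYPE(complex) m d) (module_mat TYPE(complex) p q) L \<longleftrightarrow>
     (\<forall>A \<in> carrier_mat m d. L A \<in> carrier_mat p q) \<and>
     (\<forall>A \<in> carrier_mat m d. \<forall>B \<in> carrier_mat m d. L (A + B) = L A + L B) \<and>
     (\<forall>c. \<forall>A \<in> carrier_mat m d. L (c \<cdot>\<^sub>m A) = c \<cdot>\<^sub>m L A)"
proof -
  have vs: "vectorspace class_ring (module_mat TYPE(complex) a b)" for a b
  proof -
    let ?M = "module_mat TYPE(complex) a b"
    have "Module.module class_ring ?M"
    proof (rule module_criteria)
      show "cring (class_ring :: complex ring)"
        by (rule class_cring.cring_axioms)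
      show "\<forall>v\<in>carrier ?M. \<exists>w\<in>carrier ?M. v \<oplus>\<^bsub>?M\<^esub> w = \<zero>\<^bsub>?M\<^esub>"
      proof
        fix v assume v: "v \<in> carrier ?M"
        show "\<exists>w\<in>carrier ?M. v \<oplus>\<^bsub>?M\<^esub> w = \<zero>\<^bsub>?M\<^esub>"
          by (rule bexI[of _ "- v"]) (use v in \<open>auto simp: module_mat_simps intro!: eq_matI\<close>)
      qed
    qed (auto simp: module_mat_simps algebra_simps intro!: eq_matI)
    then show ?thesis
      unfolding vectorspace_def using class_field.field_axioms by blast
  qed
  show ?thesis
    using vs[of m d] vs[of p q]
    unfolding linear_map_def mod_hom_def mod_hom_axioms_def LinearCombinations.module_hom_def vectorspace_def
    by (auto simp: module_mat_simps Pi_iff)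
qed

end

theory Submission
  imports Defs "HOL-Analysis.L2_Norm"
begin

text \<open>Put \<open>H = Xhat - X\<close> and let \<open>S\<close> be the row set kept in \<open>X\<^sup>(\<^sup>s\<^sup>)\<close>.  Feasibility of \<open>X\<close> and
  minimality of \<open>Xhat\<close> give \<open>\<parallel>\<phi> H\<parallel> \<le> 2 \<epsilon>\<close> and the cone condition that the rows of \<open>H\<close> outside \<open>S\<close>
  weigh at most those inside plus \<open>2 \<parallel>X - X\<^sup>(\<^sup>s\<^sup>)\<parallel>\<close>.  Let \<open>W\<close> be \<open>S\<close> together with the \<open>s\<close> largest remaining
  rows of \<open>H\<close>.  Expanding \<open>\<parallel>\<phi> H\<^sub>W\<parallel>\<^sup>2 = \<langle>\<phi> H\<^sub>W, \<phi> H\<rangle> - \<langle>\<phi> H\<^sub>W, \<phi> H\<^sub>R\<rangle>\<close>, where \<open>R\<close> is the complement of \<open>W\<close>, the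
  RIP bounds the left side from below and, by polarization, the last term by
  \<open>\<surd>2 \<delta> \<parallel>H\<^sub>W\<parallel>\<close> times the \<open>\<ell>\<^sup>1\<close> weight outside \<open>S\<close> over \<open>\<surd>s\<close>; this closes when
  \<open>(1 + \<surd>2) \<delta> < 1\<close>.\<close>

section \<open>Largest entries of a nonnegative family and block decompositions\<close>

lemma top_subset_exists:
  fixes h :: "'a \<Rightarrow> real"
  assumes "finite R" "k \<le> card R"
  shows "\<exists>T\<subseteq>R. card T = k \<and> (\<forall>i\<in>T. \<forall>j\<in>R - T. h j \<le> h i)"
  using assms(2)
proof (induction k)
  case 0
  then show ?case by (intro exI[of _ "{}"]) auto
next
  case (Suc k)
  then obtain T where T: "T \<subseteq> R" "card T = k" "\<forall>i\<in>T. \<forall>j\<in>R - T. h j \<le> h i" by auto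
  have "R - T \<noteq> {}" using T Suc.prems by (metis Diff_eq_empty_iff Suc_n_not_le_n subset_antisym)
  then have "Max (h ` (R - T)) \<in> h ` (R - T)" using assms(1) by (intro Max_in) auto
  then obtain x where x: "x \<in> R - T" "h x = Max (h ` (R - T))" by force
  have "h j \<le> h x" if "j \<in> R - T" for j
    unfolding x(2) using that assms(1) by (intro Max_ge) auto
  note x = x(1) this
  have "finite T" using T assms(1) finite_subset by blast
  then show ?case using T x by (intro exI[of _ "insert x T"]) auto
qed

lemma L2_set_le_bound:
  assumes "finite A" "card A \<le> s" "0 \<le> M" "\<And>i. i \<in> A \<Longrightarrow> 0 \<le> h i \<and> h i \<le> M"
  shows "L2_set h A \<le> sqrt (real s) * M"
proof -
  have "(\<Sum>i\<in>A. (h i)\<^sup>2) \<le> (\<Sum>i\<in>A. M\<^sup>2)"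
    by (intro sum_mono power_mono) (use assms in auto)
  also have "\<dots> \<le> real s * M\<^sup>2" using assms by (simp add: mult_right_mono)
  finally have "sqrt (\<Sum>i\<in>A. (h i)\<^sup>2) \<le> sqrt (real s * M\<^sup>2)" by (rule real_sqrt_le_mono)
  then show ?thesis using assms(3) by (simp add: L2_set_def real_sqrt_mult)
qed

lemma sum_le_sqrt_card_L2_set:
  assumes "card A \<le> s" "\<And>i. i \<in> A \<Longrightarrow> 0 \<le> h i"
  shows "sum h A \<le> sqrt (real s) * L2_set h A"
proof -
  have "sum h A = (\<Sum>i\<in>A. \<bar>1\<bar> * \<bar>h i\<bar>)" using assms by (intro sum.cong) auto
  also have "\<dots> \<le> L2_set (\<lambda>_. 1) A * L2_set h A" by (rule L2_set_mult_ineq)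
  also have "\<dots> \<le> sqrt (real s) * L2_set h A"
    using assms(1) by (intro mult_right_mono L2_set_nonneg) (simp add: L2_set_def)
  finally show ?thesis .
qed

lemma sqrt_card_mult_le_sum:
  assumes "finite T" "card T = s" "1 \<le> s" "\<And>i. i \<in> T \<Longrightarrow> M \<le> h i"
  shows "sqrt (real s) * M \<le> sum h T / sqrt (real s)"
proof -
  have "real s * M \<le> sum h T" using sum_bounded_below[of T M h] assms by auto
  then show ?thesis using assms(3) by (simp add: field_simps)
qed

text \<open>Peels off the leading block. If \<open>T\<close> is a full block, the minimum of
  \<open>h\<close> on \<open>T\<close> serves as \<open>M\<close>: it bounds everything left over,
  and it is at most the mean over \<open>T\<close>, which is the last inequality up to a factor
  \<open>sqrt (real s)\<close>.\<close>

lemma top_block_exists: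
  fixes h :: "'a \<Rightarrow> real"
  assumes "finite R" "1 \<le> s" "\<And>i. i \<in> R \<Longrightarrow> 0 \<le> h i"
  shows "\<exists>T\<subseteq>R. \<exists>M\<ge>0. card T \<le> s \<and> (card R \<le> s \<longrightarrow> T = R) \<and> (s < card R \<longrightarrow> card T = s)
    \<and> (\<forall>j\<in>R - T. h j \<le> M) \<and> sqrt (real s) * M \<le> sum h T / sqrt (real s)"
proof (cases "card R \<le> s")
  case True
  \<comment> \<open>Nothing is left over in this case, so the threshold can be 0.\<close>
  have "0 \<le> sum h R / sqrt (real s)" using assms(3) by (intro divide_nonneg_nonneg sum_nonneg) auto
  with True show ?thesis by (intro exI[of _ R] conjI exI[of _ 0]) auto
next
  case False
  then obtain T where T: "T \<subseteq> R" "card T = s" "\<forall>i\<in>T. \<forall>j\<in>R - T. h j \<le> h i"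
    using top_subset_exists[of R s h] assms by auto
  have fT: "finite T" "T \<noteq> {}" using T assms finite_subset by fastforce+
  define M where "M = Min (h ` T)"
  have M: "M \<in> h ` T" "\<And>i. i \<in> T \<Longrightarrow> M \<le> h i" unfolding M_def using fT by auto
  show ?thesis
    using False T M assms sqrt_card_mult_le_sum[of T s M h] fT
    by (intro exI[of _ T] conjI exI[of _ M]) auto
qed

text \<open>Stands in for splitting \<open>R\<close> into blocks of size \<open>s\<close> by decreasing \<open>h\<close>: each block's
  \<open>\<ell>\<^sup>2\<close> norm is controlled by the mean of the preceding block, and \<open>f\<close> is summed over blocks.\<close>

lemma subadditive_block_bound:
  fixes h :: "'a \<Rightarrow> real" and f :: "'a set \<Rightarrow> real"
  assumes "finite R" "1 \<le> s" "0 \<le> c" "0 \<le> M" "\<And>i. i \<in> R \<Longrightarrow> 0 \<le> h i \<and> h i \<le> M"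
    and "\<And>A B. A \<subseteq> R \<Longrightarrow> B \<subseteq> R \<Longrightarrow> A \<inter> B = {} \<Longrightarrow> f (A \<union> B) \<le> f A + f B"
    and "\<And>A. A \<subseteq> R \<Longrightarrow> card A \<le> s \<Longrightarrow> f A \<le> c * L2_set h A"
  shows "f R \<le> c * (sqrt (real s) * M + sum h R / sqrt (real s))"
  using assms
proof (induction "card R" arbitrary: R M rule: less_induct)
  case less
  obtain T M' where T: "T \<subseteq> R" "0 \<le> M'" "card T \<le> s" "card R \<le> s \<longrightarrow> T = R"
      "s < card R \<longrightarrow> card T = s" "\<forall>j\<in>R - T. h j \<le> M'"
      "sqrt (real s) * M' \<le> sum h T / sqrt (real s)"
    using top_block_exists[of R s h] less.prems(1,2,5) by blast
  have fT: "finite T" using T less.prems finite_subset by blast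
  \<comment> \<open>The leading block has no predecessor inside \<open>R\<close>; the given bound
    \<open>M\<close> takes the place of the preceding mean.\<close>
  have fT_le: "f T \<le> c * (sqrt (real s) * M)"
  proof -
    have "f T \<le> c * L2_set h T" using T less.prems(7) by blast
    also have "L2_set h T \<le> sqrt (real s) * M"
      by (rule L2_set_le_bound) (use T fT less.prems in auto)
    finally show ?thesis using less.prems(3) by (simp add: mult_left_mono)
  qed
  show ?case
  proof (cases "card R \<le> s")
    case True
    have "0 \<le> sum h R / sqrt (real s)" using less.prems(5) by (intro divide_nonneg_nonneg sum_nonneg) auto
    then show ?thesis using fT_le True T less.prems(3)
      by (smt (verit) mult_left_mono)
  next
    case False
    have "card (R - T) < card R"
      using False T fT less.prems by (simp add: card_Diff_subset)
    then have "f (R - T) \<le> c * (sqrt (real s) * M' + sum h (R - T) / sqrt (real s))"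
    proof (rule less.hyps)
      show "f (A \<union> B) \<le> f A + f B" if "A \<subseteq> R - T" "B \<subseteq> R - T" "A \<inter> B = {}" for A B
        using less.prems(6)[of A B] that by blast
      show "f A \<le> c * L2_set h A" if "A \<subseteq> R - T" "card A \<le> s" for A
        using less.prems(7)[of A] that by blast
    qed (use less.prems(1-5) T in auto)
    \<comment> \<open>The threshold \<open>M'\<close> handed to the remainder is paid for by the sum
      over \<open>T\<close>, so the contributions reassemble to the sum over
      \<open>R\<close>.\<close>
    also have "\<dots> \<le> c * (sum h T / sqrt (real s) + sum h (R - T) / sqrt (real s))"
      using T less.prems(3) by (intro mult_left_mono) auto
    also have "\<dots> = c * (sum h R / sqrt (real s))"
      using sum.subset_diff[OF T(1) less.prems(1), of h] by (simp add: add_divide_distrib)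
    finally have "f (R - T) \<le> c * (sum h R / sqrt (real s))" .
    moreover have "f R \<le> f T + f (R - T)"
      using less.prems(6)[of T "R - T"] T by (simp add: Un_absorb1)
    ultimately show ?thesis using fT_le by (simp add: algebra_simps)
  qed
qed

section \<open>Row norms, mixed norms and the real Frobenius inner product\<close>

abbreviation row_norm :: "complex mat \<Rightarrow> nat \<Rightarrow> real" where
  "row_norm A i \<equiv> lp_norm 2 (row A i)"

lemma lp_norm_2: "lp_norm 2 v = L2_set (\<lambda>i. cmod (v $ i)) {..<dim_vec v}"
  unfolding lp_norm_def L2_set_def by (simp add: powr_half_sqrt sum_nonneg)

lemma row_norm_eq:
  assumes "A \<in> carrier_mat r c" "i < r"
  shows "row_norm A i = L2_set (\<lambda>j. cmod (A $$ (i, j))) {..<c}"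
  using assms unfolding lp_norm_2 by (intro L2_set_cong) auto

lemma row_norm_nonneg [simp]: "0 \<le> row_norm A i"
  by (simp add: lp_norm_2)

lemma mixed_norm_1_2: "mixed_norm 1 2 A = (\<Sum>i<dim_row A. row_norm A i)"
  unfolding mixed_norm_def by (simp add: sum_nonneg)

lemma mixed_norm_2_2: "mixed_norm 2 2 A = L2_set (row_norm A) {..<dim_row A}"
  unfolding mixed_norm_def L2_set_def by (simp add: powr_half_sqrt sum_nonneg)

lemma mixed_norm_2_2_nonneg [simp]: "0 \<le> mixed_norm 2 2 A"
  by (simp add: mixed_norm_2_2)

lemma row_norm_triangle:
  assumes "A \<in> carrier_mat r c" "B \<in> carrier_mat r c" "i < r"
  shows "row_norm (A + B) i \<le> row_norm A i + row_norm B i"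
proof -
  have "row_norm (A + B) i = L2_set (\<lambda>j. cmod (A $$ (i, j) + B $$ (i, j))) {..<c}"
    using assms by (subst row_norm_eq[of _ r c]) (auto intro!: L2_set_cong)
  also have "\<dots> \<le> L2_set (\<lambda>j. cmod (A $$ (i, j)) + cmod (B $$ (i, j))) {..<c}"
    by (intro L2_set_mono) (auto simp: norm_triangle_ineq)
  also have "\<dots> \<le> row_norm A i + row_norm B i"
    using assms by (simp add: row_norm_eq L2_set_triangle_ineq)
  finally show ?thesis .
qed

lemma row_norm_uminus:
  assumes "A \<in> carrier_mat r c" "i < r"
  shows "row_norm (- A) i = row_norm A i"
  using assms by (subst (1 2) row_norm_eq[of _ r c]) (auto intro!: L2_set_cong)

lemma mixed_norm_2_2_triangle:
  assumes "A \<in> carrier_mat r c" "B \<in> carrier_mat r c"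
  shows "mixed_norm 2 2 (A + B) \<le> mixed_norm 2 2 A + mixed_norm 2 2 B"
proof -
  have "mixed_norm 2 2 (A + B) \<le> L2_set (\<lambda>i. row_norm A i + row_norm B i) {..<r}"
    using assms row_norm_triangle[OF assms] unfolding mixed_norm_2_2
    by (auto intro!: L2_set_mono)
  also have "\<dots> \<le> mixed_norm 2 2 A + mixed_norm 2 2 B"
    using assms unfolding mixed_norm_2_2 by (auto intro: L2_set_triangle_ineq)
  finally show ?thesis .
qed

lemma mixed_norm_2_2_uminus: "mixed_norm 2 2 (- A) = mixed_norm 2 2 A"
  unfolding mixed_norm_2_2 by (auto intro!: L2_set_cong row_norm_uminus)

text \<open>The real part of the usual complex inner product. Matrices are treated as a real
  Euclidean space, so polarization needs only two signs and no multiples by the imaginary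
  unit.\<close>

definition frob_inner :: "complex mat \<Rightarrow> complex mat \<Rightarrow> real" where
  "frob_inner A B =
     (\<Sum>i<dim_row A. \<Sum>j<dim_col A. Re (cnj (A $$ (i, j)) * B $$ (i, j)))"

lemma frob_inner_self: "frob_inner A A = (mixed_norm 2 2 A)\<^sup>2"
proof -
  have Re_sq: "Re (cnj z * z) = (cmod z)\<^sup>2" for z
    unfolding cmod_power2 by (simp add: power2_eq_square)
  have "(row_norm A i)\<^sup>2 = (\<Sum>j<dim_col A. Re (cnj (A $$ (i, j)) * A $$ (i, j)))"
    if "i < dim_row A" for i
    unfolding Re_sq using that
    by (subst row_norm_eq[of _ "dim_row A" "dim_col A"]) (auto simp: L2_set_def sum_nonneg)
  then show ?thesis
    unfolding mixed_norm_2_2 frob_inner_def L2_set_def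
    by (simp add: sum_nonneg del: complex_cnj_mult)
qed

lemma frob_inner_add_right:
  assumes "A \<in> carrier_mat r c" "B \<in> carrier_mat r c" "C \<in> carrier_mat r c"
  shows "frob_inner A (B + C) = frob_inner A B + frob_inner A C"
  using assms unfolding frob_inner_def by (simp add: sum.distrib ring_distribs)

lemma frob_inner_add_left:
  assumes "A \<in> carrier_mat r c" "B \<in> carrier_mat r c" "C \<in> carrier_mat r c"
  shows "frob_inner (A + B) C = frob_inner A C + frob_inner B C"
  using assms unfolding frob_inner_def by (simp add: sum.distrib ring_distribs)

text \<open>With real coefficients the two conjugate cross terms merge into one multiple of
  \<open>frob_inner A B\<close>; this is the expansion that polarization subtracts.\<close>

lemma mixed_norm_2_2_lincomb_sq:
  assumes "A \<in> carrier_mat r c" "B \<in> carrier_mat r c"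
  shows "(mixed_norm 2 2 (complex_of_real x \<cdot>\<^sub>m A + complex_of_real y \<cdot>\<^sub>m B))\<^sup>2
    = x\<^sup>2 * (mixed_norm 2 2 A)\<^sup>2 + 2 * x * y * frob_inner A B + y\<^sup>2 * (mixed_norm 2 2 B)\<^sup>2"
proof -
  let ?C = "complex_of_real x \<cdot>\<^sub>m A + complex_of_real y \<cdot>\<^sub>m B"
  have "Re (cnj (of_real x * z + of_real y * w) * (of_real x * z + of_real y * w))
      = x\<^sup>2 * Re (cnj z * z) + 2 * x * y * Re (cnj z * w) + y\<^sup>2 * Re (cnj w * w)" for z w
    by (simp add: algebra_simps power2_eq_square)
  then have "frob_inner ?C ?C = (\<Sum>i<r. \<Sum>j<c. x\<^sup>2 * Re (cnj (A $$ (i, j)) * A $$ (i, j))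
      + 2 * x * y * Re (cnj (A $$ (i, j)) * B $$ (i, j))
      + y\<^sup>2 * Re (cnj (B $$ (i, j)) * B $$ (i, j)))"
    using assms unfolding frob_inner_def by (auto intro!: sum.cong)
  also have "\<dots> = x\<^sup>2 * frob_inner A A + 2 * x * y * frob_inner A B + y\<^sup>2 * frob_inner B B"
    using assms unfolding frob_inner_def carrier_matD[OF assms(1)] carrier_matD[OF assms(2)]
    by (simp only: sum.distrib sum_distrib_left)
  finally show ?thesis by (simp add: frob_inner_self)
qed

lemma frob_inner_Cauchy_Schwarz:
  assumes "A \<in> carrier_mat r c" "B \<in> carrier_mat r c"
  shows "\<bar>frob_inner A B\<bar> \<le> mixed_norm 2 2 A * mixed_norm 2 2 B"
proof -
  have "\<bar>\<Sum>j<c. Re (cnj (A $$ (i, j)) * B $$ (i, j))\<bar> \<le> \<bar>row_norm A i\<bar> * \<bar>row_norm B i\<bar>"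
    if "i < r" for i
  proof -
    have "\<bar>\<Sum>j<c. Re (cnj (A $$ (i, j)) * B $$ (i, j))\<bar>
        \<le> (\<Sum>j<c. \<bar>cmod (A $$ (i, j))\<bar> * \<bar>cmod (B $$ (i, j))\<bar>)"
      by (rule order_trans[OF sum_abs], rule sum_mono)
        (metis abs_Re_le_cmod abs_norm_cancel complex_mod_cnj norm_mult)
    also have "\<dots> \<le> row_norm A i * row_norm B i"
      using assms that by (simp only: row_norm_eq) (rule L2_set_mult_ineq)
    finally show ?thesis by simp
  qed
  then have "\<bar>frob_inner A B\<bar> \<le> (\<Sum>i<r. \<bar>row_norm A i\<bar> * \<bar>row_norm B i\<bar>)"
    using assms unfolding frob_inner_def
    by (intro order_trans[OF sum_abs]) (auto intro!: sum_mono)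
  also have "\<dots> \<le> mixed_norm 2 2 A * mixed_norm 2 2 B"
    using assms unfolding mixed_norm_2_2 by (simp only: carrier_matD) (rule L2_set_mult_ineq)
  finally show ?thesis .
qed

section \<open>Restriction to a set of rows, and row sparsity\<close>

lemma keep_rows_carrier [simp]: "H \<in> carrier_mat m d \<Longrightarrow> keep_rows T H \<in> carrier_mat m d"
  by (simp add: keep_rows_def)

lemma keep_rows_Un:
  assumes "A \<inter> B = {}"
  shows "keep_rows (A \<union> B) H = keep_rows A H + keep_rows B H"
  using assms by (intro eq_matI) (auto simp: keep_rows_def)

lemma keep_rows_all: "H \<in> carrier_mat m d \<Longrightarrow> keep_rows {..<m} H = H"
  by (intro eq_matI) (auto simp: keep_rows_def)

lemma row_norm_keep_rows:
  assumes "H \<in> carrier_mat m d" "i < m"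
  shows "row_norm (keep_rows T H) i = (if i \<in> T then row_norm H i else 0)"
  using assms by (subst (1 2) row_norm_eq[of _ m d]) (auto simp: keep_rows_def L2_set_def)

lemma mixed_norm_2_2_keep_rows:
  assumes "H \<in> carrier_mat m d" "T \<subseteq> {..<m}"
  shows "mixed_norm 2 2 (keep_rows T H) = L2_set (row_norm H) T"
proof -
  have "(\<Sum>i<m. (row_norm (keep_rows T H) i)\<^sup>2) = (\<Sum>i<m. if i \<in> T then (row_norm H i)\<^sup>2 else 0)"
    using assms by (intro sum.cong) (auto simp: row_norm_keep_rows)
  also have "\<dots> = (\<Sum>i\<in>T. (row_norm H i)\<^sup>2)"
    using assms by (simp add: sum.inter_restrict[symmetric] Int_absorb1)
  finally show ?thesis using assms by (simp add: mixed_norm_2_2 L2_set_def keep_rows_def)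
qed

lemma row_sparseI:
  assumes "Z \<in> carrier_mat m d" "finite T" "card T \<le> k"
    and "\<And>i j. i < m \<Longrightarrow> j < d \<Longrightarrow> i \<notin> T \<Longrightarrow> Z $$ (i, j) = 0"
  shows "row_sparse k Z"
proof -
  have "{i. i < dim_row Z \<and> row Z i \<noteq> 0\<^sub>v (dim_col Z)} \<subseteq> T"
    using assms by (auto intro!: eq_vecI)
  then show ?thesis unfolding row_sparse_def using assms card_mono le_trans by blast
qed

section \<open>Linearity of the measurement map\<close>

lemma columnwise_map_carrier [simp]: "columnwise_map n d \<Phi> Z \<in> carrier_mat n d"
  using mat_of_cols_carrier(1)[of n "map (\<lambda>j. \<Phi> j *\<^sub>v col Z j) [0..<d]"]
  by (simp add: columnwise_map_def)

lemma columnwise_map_dim [simp]: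
  "dim_row (columnwise_map n d \<Phi> Z) = n" "dim_col (columnwise_map n d \<Phi> Z) = d"
  using carrier_matD[OF columnwise_map_carrier[of n d \<Phi> Z]] by auto

lemma columnwise_map_index:
  assumes "Z \<in> carrier_mat m d" "\<forall>j<d. \<Phi> j \<in> carrier_mat n m" "i < n" "j < d"
  shows "columnwise_map n d \<Phi> Z $$ (i, j) = (\<Sum>k<m. \<Phi> j $$ (i, k) * Z $$ (k, j))"
proof -
  have "columnwise_map n d \<Phi> Z $$ (i, j) = row (\<Phi> j) i \<bullet> col Z j"
    using assms by (auto simp: columnwise_map_def mat_of_cols_index)
  also have "\<dots> = (\<Sum>k<m. \<Phi> j $$ (i, k) * Z $$ (k, j))"
    using assms by (auto simp: scalar_prod_def lessThan_atLeast0 intro!: sum.cong)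
  finally show ?thesis .
qed

lemma columnwise_map_add:
  assumes "A \<in> carrier_mat m d" "B \<in> carrier_mat m d" "\<forall>j<d. \<Phi> j \<in> carrier_mat n m"
  shows "columnwise_map n d \<Phi> (A + B) = columnwise_map n d \<Phi> A + columnwise_map n d \<Phi> B"
proof (rule eq_matI)
  fix i j
  assume "i < dim_row (columnwise_map n d \<Phi> A + columnwise_map n d \<Phi> B)"
    and "j < dim_col (columnwise_map n d \<Phi> A + columnwise_map n d \<Phi> B)"
  then have ij: "i < n" "j < d" by auto
  have "(\<Sum>k<m. \<Phi> j $$ (i, k) * (A + B) $$ (k, j))
      = (\<Sum>k<m. \<Phi> j $$ (i, k) * A $$ (k, j) + \<Phi> j $$ (i, k) * B $$ (k, j))"
    using assms ij by (intro sum.cong) (auto simp: distrib_left)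
  then show "columnwise_map n d \<Phi> (A + B) $$ (i, j)
      = (columnwise_map n d \<Phi> A + columnwise_map n d \<Phi> B) $$ (i, j)"
    using assms ij by (simp add: columnwise_map_index[of _ m] sum.distrib)
qed auto

lemma columnwise_map_smult:
  assumes "A \<in> carrier_mat m d" "\<forall>j<d. \<Phi> j \<in> carrier_mat n m"
  shows "columnwise_map n d \<Phi> (a \<cdot>\<^sub>m A) = a \<cdot>\<^sub>m columnwise_map n d \<Phi> A"
proof (rule eq_matI)
  fix i j
  assume "i < dim_row (a \<cdot>\<^sub>m columnwise_map n d \<Phi> A)"
    and "j < dim_col (a \<cdot>\<^sub>m columnwise_map n d \<Phi> A)"
  then have ij: "i < n" "j < d" by auto
  have "(\<Sum>k<m. \<Phi> j $$ (i, k) * (a \<cdot>\<^sub>m A) $$ (k, j))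
      = (\<Sum>k<m. a * (\<Phi> j $$ (i, k) * A $$ (k, j)))"
    using assms ij by (intro sum.cong) auto
  then show "columnwise_map n d \<Phi> (a \<cdot>\<^sub>m A) $$ (i, j)
      = (a \<cdot>\<^sub>m columnwise_map n d \<Phi> A) $$ (i, j)"
    using assms ij by (simp add: columnwise_map_index[of _ m] sum_distrib_left)
qed auto

section \<open>Consequences of the restricted isometry property\<close>

lemma row_sparse_RIP_nonneg:
  assumes "row_sparse_RIP m d \<phi> k \<delta>" "1 \<le> m" "1 \<le> d" "1 \<le> k"
  shows "0 \<le> \<delta>"
proof -
  \<comment> \<open>Only one row is nonzero, so the RIP applies, and the norm is positive; the two
    RIP bounds then force \<open>1 - \<delta> \<le> 1 + \<delta>\<close>.\<close>
  define Z :: "complex mat" where "Z = mat m d (\<lambda>(i, j). if i = 0 then 1 else 0)"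
  have Z: "Z \<in> carrier_mat m d" by (simp add: Z_def)
  have "row_sparse k Z"
    by (rule row_sparseI[OF Z, of "{0}"]) (use assms in \<open>auto simp: Z_def\<close>)
  then have "(1 - \<delta>) * (mixed_norm 2 2 Z)\<^sup>2 \<le> (1 + \<delta>) * (mixed_norm 2 2 Z)\<^sup>2"
    using assms(1) Z unfolding row_sparse_RIP_def by fastforce
  moreover have "0 < (mixed_norm 2 2 Z)\<^sup>2"
  proof -
    have "row_norm Z 0 \<le> mixed_norm 2 2 Z"
      unfolding mixed_norm_2_2 by (rule member_le_L2_set) (use Z assms in auto)
    moreover have "0 < row_norm Z 0"
      using assms by (subst row_norm_eq[OF Z]) (auto simp: Z_def L2_set_def)
    ultimately show ?thesis by auto
  qed
  ultimately show ?thesis by (simp add: mult_le_cancel_right)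
qed

text \<open>Polarization: with \<open>a\<close>, \<open>b\<close> the norms of the two pieces \<open>A\<close>, \<open>B\<close>, the RIP is applied to
  \<open>b A + a B\<close> and \<open>b A - a B\<close>, both of squared norm \<open>2 a\<^sup>2 b\<^sup>2\<close>.\<close>

lemma row_sparse_RIP_frob_inner:
  assumes \<phi>: "\<phi> = columnwise_map n d \<Phi>" and \<Phi>: "\<forall>j<d. \<Phi> j \<in> carrier_mat n m"
    and RIP: "row_sparse_RIP m d \<phi> k \<delta>" and H: "H \<in> carrier_mat m d"
    and T: "T \<subseteq> {..<m}" "U \<subseteq> {..<m}" "T \<inter> U = {}" "card T + card U \<le> k"
  shows "\<bar>frob_inner (\<phi> (keep_rows T H)) (\<phi> (keep_rows U H))\<bar>
    \<le> \<delta> * (L2_set (row_norm H) T * L2_set (row_norm H) U)"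
proof -
  define A B where "A = keep_rows T H" and "B = keep_rows U H"
  define a b where "a = L2_set (row_norm H) T" and "b = L2_set (row_norm H) U"
  have AB: "A \<in> carrier_mat m d" "B \<in> carrier_mat m d" using H by (auto simp: A_def B_def)
  have norms: "mixed_norm 2 2 A = a" "mixed_norm 2 2 B = b"
    using H T by (auto simp: A_def B_def a_def b_def mixed_norm_2_2_keep_rows)
  have \<phi>AB: "\<phi> A \<in> carrier_mat n d" "\<phi> B \<in> carrier_mat n d" by (auto simp: \<phi>)
  have fin: "finite T" "finite U" using T finite_subset[OF _ finite_lessThan] by blast+
  have nonneg: "0 \<le> a" "0 \<le> b" by (auto simp: a_def b_def)
  let ?Z = "\<lambda>x y. complex_of_real x \<cdot>\<^sub>m A + complex_of_real y \<cdot>\<^sub>m B"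
  have Z: "?Z x y \<in> carrier_mat m d" for x y using AB by auto
  have sparse: "row_sparse k (?Z x y)" for x y
    by (rule row_sparseI[OF Z, of "T \<union> U"])
      (use fin T H in \<open>auto simp: card_Un_disjoint A_def B_def keep_rows_def\<close>)
  have orth: "frob_inner A B = 0"
    using T(3) H unfolding frob_inner_def A_def B_def keep_rows_def
    by (intro sum.neutral ballI) auto
  have normZ: "(mixed_norm 2 2 (?Z x y))\<^sup>2 = x\<^sup>2 * a\<^sup>2 + y\<^sup>2 * b\<^sup>2" for x y
    using mixed_norm_2_2_lincomb_sq[OF AB] orth norms by simp
  have "\<phi> (?Z x y) = complex_of_real x \<cdot>\<^sub>m \<phi> A + complex_of_real y \<cdot>\<^sub>m \<phi> B" for x y
    using AB \<Phi> by (simp add: \<phi> columnwise_map_add[of _ m] columnwise_map_smult[of _ m])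
  then have norm\<phi>Z: "(mixed_norm 2 2 (\<phi> (?Z x y)))\<^sup>2 = x\<^sup>2 * (mixed_norm 2 2 (\<phi> A))\<^sup>2
      + 2 * x * y * frob_inner (\<phi> A) (\<phi> B) + y\<^sup>2 * (mixed_norm 2 2 (\<phi> B))\<^sup>2" for x y
    using mixed_norm_2_2_lincomb_sq[OF \<phi>AB] by simp
  have RIPZ: "(1 - \<delta>) * (x\<^sup>2 * a\<^sup>2 + y\<^sup>2 * b\<^sup>2) \<le> (mixed_norm 2 2 (\<phi> (?Z x y)))\<^sup>2"
    "(mixed_norm 2 2 (\<phi> (?Z x y)))\<^sup>2 \<le> (1 + \<delta>) * (x\<^sup>2 * a\<^sup>2 + y\<^sup>2 * b\<^sup>2)" for x y
    using RIP Z[of x y] sparse[of x y]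
    unfolding row_sparse_RIP_def normZ[of x y, symmetric] by blast+
  let ?g = "frob_inner (\<phi> A) (\<phi> B)"
  have "\<bar>?g\<bar> \<le> \<delta> * (a * b)"
  \<comment> \<open>The cross-scaled combinations carry no information if a piece vanishes. Then the
    RIP applied to that piece alone shows that its image is zero, and Cauchy-Schwarz
    finishes.\<close>
  proof (cases "a = 0 \<or> b = 0")
    case True
    have "mixed_norm 2 2 (\<phi> A) = 0" if "a = 0" using RIPZ(2)[of 1 0] norm\<phi>Z[of 1 0] that by simp
    moreover have "mixed_norm 2 2 (\<phi> B) = 0" if "b = 0"
      using RIPZ(2)[of 0 1] norm\<phi>Z[of 0 1] that by simp
    ultimately show ?thesis using frob_inner_Cauchy_Schwarz[OF \<phi>AB] True by auto
  next
    case False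
    then have ab: "0 < a * b" using nonneg by simp
    let ?F = "\<lambda>x y. (mixed_norm 2 2 (\<phi> (?Z x y)))\<^sup>2"
    \<comment> \<open>The pure square terms cancel. The difference is then estimated by the upper
      RIP bound for one sign and the lower bound for the other, in both orders.\<close>
    have diff: "4 * (a * b * ?g) = ?F b a - ?F b (- a)" unfolding norm\<phi>Z by simp
    let ?c = "b\<^sup>2 * a\<^sup>2 + a\<^sup>2 * b\<^sup>2"
    have "?F b a - ?F b (- a) \<le> (1 + \<delta>) * ?c - (1 - \<delta>) * ?c"
      "?F b (- a) - ?F b a \<le> (1 + \<delta>) * ?c - (1 - \<delta>) * ?c"
      using RIPZ[of b a] RIPZ[of b "- a"] unfolding power2_minus by linarith+
    moreover have "(1 + \<delta>) * ?c - (1 - \<delta>) * ?c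
        = 4 * (a * b * (\<delta> * (a * b)))"
      by (simp add: algebra_simps power2_eq_square)
    ultimately have "a * b * ?g \<le> a * b * (\<delta> * (a * b))" "a * b * (- ?g) \<le> a * b * (\<delta> * (a * b))"
      using diff by linarith+
    then have "?g \<le> \<delta> * (a * b)" "- ?g \<le> \<delta> * (a * b)"
      using ab by (simp_all only: mult_le_cancel_left_pos)
    then show ?thesis by linarith
  qed
  then show ?thesis by (simp add: A_def B_def a_def b_def)
qed

section \<open>Error bound for any matrix satisfying the cone and tube conditions\<close>

lemma recovery_bound:
  assumes \<phi>: "\<phi> = columnwise_map n d \<Phi>" and \<Phi>: "\<forall>j<d. \<Phi> j \<in> carrier_mat n m"
    and RIP: "row_sparse_RIP m d \<phi> (2 * s) \<delta>" and H: "H \<in> carrier_mat m d"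
    and s: "1 \<le> s" and \<delta>: "0 \<le> \<delta>" "\<delta> < sqrt 2 - 1"
    and S: "S \<subseteq> {..<m}" "card S \<le> s"
    and cone: "sum (row_norm H) ({..<m} - S) \<le> sum (row_norm H) S + 2 * \<sigma>" and \<sigma>: "0 \<le> \<sigma>"
    and tube: "mixed_norm 2 2 (\<phi> H) \<le> 2 * \<epsilon>"
  shows "mixed_norm 2 2 H
    \<le> (4 * sqrt 2 * \<delta> / (1 - (1 + sqrt 2) * \<delta>) + 2) * (\<sigma> / sqrt (real s))
      + 4 * sqrt (1 + \<delta>) / (1 - (1 + sqrt 2) * \<delta>) * \<epsilon>"
proof -
  define h where "h = row_norm H"
  have h0: "0 \<le> h i" for i by (simp add: h_def)
  obtain T M where T: "T \<subseteq> {..<m} - S" "0 \<le> M" "card T \<le> s"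
      "\<forall>j\<in>({..<m} - S) - T. h j \<le> M" "sqrt (real s) * M \<le> sum h T / sqrt (real s)"
    using top_block_exists[of "{..<m} - S" s h] s h0 by blast
  define R where "R = {..<m} - S - T"
  define W where "W = S \<union> T"
  \<comment> \<open>The sum runs over all rows outside \<open>S\<close>, including \<open>T\<close>:
    the share of \<open>T\<close> pays for the first block of \<open>R\<close> in
    \<open>tail\<close>.\<close>
  define \<tau> where "\<tau> = sum h ({..<m} - S) / sqrt (real s)"
  define N where "N = L2_set h W"
  define a b where "a = L2_set h S" and "b = L2_set h T"
  define P Q where "P = \<phi> (keep_rows W H)" and "Q = \<phi> (keep_rows R H)"
  have fin: "finite S" "finite T" "finite W" "finite R"
    using S(1) T(1) finite_subset[OF _ finite_lessThan[of m]] unfolding W_def R_def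
    by (blast intro: finite_subset)+
  have sub: "T \<subseteq> {..<m}" "W \<subseteq> {..<m}" "R \<subseteq> {..<m}" "S \<inter> T = {}" "W \<inter> R = {}" "W \<union> R = {..<m}"
    using S T by (auto simp: W_def R_def)
  have nonneg: "0 \<le> a" "0 \<le> b" "0 \<le> N" by (auto simp: a_def b_def N_def)
  have spos: "0 < sqrt (real s)" using s by simp
  have \<phi>_add: "\<phi> (keep_rows (A \<union> B) H) = \<phi> (keep_rows A H) + \<phi> (keep_rows B H)"
    if "A \<inter> B = {}" for A B
    using that H \<Phi> by (simp add: \<phi> keep_rows_Un columnwise_map_add[of _ m])
  have \<phi>_car: "\<phi> Z \<in> carrier_mat n d" for Z by (simp add: \<phi>)
  \<comment> \<open>Kept general in \<open>f\<close> because it serves twice: for inner products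
    with a fixed image, and for the norm of the rows in \<open>R\<close>.\<close>
  have tail: "f R \<le> c * \<tau>"
    if "0 \<le> c" and "\<And>A B. A \<subseteq> R \<Longrightarrow> B \<subseteq> R \<Longrightarrow> A \<inter> B = {} \<Longrightarrow> f (A \<union> B) \<le> f A + f B"
      and "\<And>A. A \<subseteq> R \<Longrightarrow> card A \<le> s \<Longrightarrow> f A \<le> c * L2_set h A" for f c
  proof -
    have "f R \<le> c * (sqrt (real s) * M + sum h R / sqrt (real s))"
      by (rule subadditive_block_bound[OF fin(4) s that(1) T(2)])
        (use that T h0 in \<open>auto simp: R_def\<close>)
    also have "\<dots> \<le> c * (sum h T / sqrt (real s) + sum h R / sqrt (real s))"
      using T that(1) by (intro mult_left_mono) auto
    also have "\<dots> = c * \<tau>"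
      using sum.subset_diff[OF T(1), of h] by (simp add: \<tau>_def R_def add_divide_distrib)
    finally show ?thesis .
  qed
  \<comment> \<open>\<open>V\<close> will be \<open>S\<close> or \<open>T\<close>. With at most
    \<open>s\<close> rows it can be paired with a block of at most \<open>s\<close> rows within the
    RIP order \<open>2 * s\<close>; the whole of \<open>W\<close> might be too large for
    that.\<close>
  have inner_tail: "\<bar>frob_inner (\<phi> (keep_rows V H)) Q\<bar> \<le> \<delta> * L2_set h V * \<tau>"
    if V: "V \<subseteq> W" "card V \<le> s" for V
    unfolding Q_def
  proof (rule tail)
    fix A assume A: "A \<subseteq> R" "card A \<le> s"
    have "V \<subseteq> {..<m}" "A \<subseteq> {..<m}" "V \<inter> A = {}" using A V sub by blast+
    then show "\<bar>frob_inner (\<phi> (keep_rows V H)) (\<phi> (keep_rows A H))\<bar>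
        \<le> \<delta> * L2_set h V * L2_set h A"
      using row_sparse_RIP_frob_inner[OF \<phi> \<Phi> RIP H, of V A] A V by (simp add: h_def mult.assoc)
  qed (auto simp: \<phi>_add \<phi>_car frob_inner_add_right[of _ n d] \<delta>)
  have N_sq: "N\<^sup>2 = a\<^sup>2 + b\<^sup>2"
    using fin sub unfolding N_def a_def b_def W_def
    by (simp add: L2_set_def sum_nonneg sum.union_disjoint)
  \<comment> \<open>The price of treating \<open>S\<close> and \<open>T\<close> separately, and the
    origin of the \<open>sqrt 2\<close> in the condition on \<delta>.\<close>
  have ab: "a + b \<le> sqrt 2 * N"
  proof (rule power2_le_imp_le)
    show "(a + b)\<^sup>2 \<le> (sqrt 2 * N)\<^sup>2"
      using sum_squares_bound[of a b] by (simp add: power_mult_distrib N_sq power2_sum)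
  qed (use nonneg in simp)
  have "a\<^sup>2 \<le> N\<^sup>2" by (simp add: N_sq)
  then have aN: "a \<le> N" using nonneg(3) by (rule power2_le_imp_le)
  define e where "e = \<sigma> / sqrt (real s)"
  have e0: "0 \<le> e" using \<sigma> by (simp add: e_def)
  have \<tau>0: "0 \<le> \<tau>" by (simp add: \<tau>_def h0 sum_nonneg)
  \<comment> \<open>The cone condition, then Cauchy-Schwarz over the at most \<open>s\<close> rows
    of \<open>S\<close>, then \<open>a \<le> N\<close>.\<close>
  have \<tau>: "\<tau> \<le> N + 2 * e"
  proof -
    have "sum h ({..<m} - S) \<le> sqrt (real s) * a + 2 * \<sigma>"
      using cone sum_le_sqrt_card_L2_set[OF S(2), of h] h0 by (simp add: h_def a_def)
    then have "\<tau> \<le> a + 2 * e" using spos by (simp add: \<tau>_def e_def field_simps)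
    then show ?thesis using aN by simp
  qed
  have "card W \<le> 2 * s" using card_Un_le[of S T] S T by (simp add: W_def)
  then have "row_sparse (2 * s) (keep_rows W H)"
    using H fin by (intro row_sparseI[of _ m d W]) (auto simp: keep_rows_def)
  moreover have normW: "mixed_norm 2 2 (keep_rows W H) = N"
    using mixed_norm_2_2_keep_rows[OF H sub(2)] by (simp add: N_def h_def)
  ultimately have RIPW: "(1 - \<delta>) * N\<^sup>2 \<le> (mixed_norm 2 2 P)\<^sup>2"
      "(mixed_norm 2 2 P)\<^sup>2 \<le> (1 + \<delta>) * N\<^sup>2"
    using RIP H unfolding row_sparse_RIP_def P_def by (metis keep_rows_carrier)+
  have P_le: "mixed_norm 2 2 P \<le> sqrt (1 + \<delta>) * N"
    by (rule power2_le_imp_le) (use RIPW \<delta> nonneg in \<open>simp_all add: power_mult_distrib\<close>)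
  have \<epsilon>0: "0 \<le> \<epsilon>" using tube mixed_norm_2_2_nonneg[of "\<phi> H"] by linarith
  have car: "P \<in> carrier_mat n d" "Q \<in> carrier_mat n d" by (auto simp: P_def Q_def \<phi>_car)
  have "\<phi> H = P + Q"
    using \<phi>_add[of W R] sub keep_rows_all[OF H] by (simp add: P_def Q_def)
  then have "frob_inner P P = frob_inner P (\<phi> H) - frob_inner P Q"
    using car by (simp add: frob_inner_add_right[of _ n d])
  moreover have "frob_inner P (\<phi> H) \<le> sqrt (1 + \<delta>) * N * (2 * \<epsilon>)"
  proof -
    have "frob_inner P (\<phi> H) \<le> mixed_norm 2 2 P * mixed_norm 2 2 (\<phi> H)"
      using frob_inner_Cauchy_Schwarz[OF car(1) \<phi>_car[of H]] by linarith
    also have "\<dots> \<le> sqrt (1 + \<delta>) * N * (2 * \<epsilon>)"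
      using P_le tube nonneg \<delta> by (intro mult_mono) auto
    finally show ?thesis .
  qed
  moreover have "- frob_inner P Q \<le> \<delta> * (sqrt 2 * N) * \<tau>"
  proof -
    have "P = \<phi> (keep_rows S H) + \<phi> (keep_rows T H)"
      using \<phi>_add sub by (simp add: P_def W_def)
    then have "- frob_inner P Q
        \<le> \<bar>frob_inner (\<phi> (keep_rows S H)) Q\<bar> + \<bar>frob_inner (\<phi> (keep_rows T H)) Q\<bar>"
      using car \<phi>_car by (simp add: frob_inner_add_left[of _ n d])
    also have "\<dots> \<le> \<delta> * (a + b) * \<tau>"
      using inner_tail[of S] inner_tail[of T] S T by (simp add: W_def a_def b_def algebra_simps)
    also have "\<dots> \<le> \<delta> * (sqrt 2 * N) * \<tau>"
      using ab \<delta> \<tau>0 by (intro mult_right_mono mult_left_mono)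
    finally show ?thesis .
  qed
  ultimately have "(1 - \<delta>) * N\<^sup>2 \<le> sqrt (1 + \<delta>) * N * (2 * \<epsilon>) + \<delta> * (sqrt 2 * N) * \<tau>"
    using RIPW(1) by (simp add: frob_inner_self)
  also have "\<dots> \<le> sqrt (1 + \<delta>) * N * (2 * \<epsilon>) + \<delta> * (sqrt 2 * N) * (N + 2 * e)"
    using \<tau> \<delta> nonneg by (intro add_left_mono mult_left_mono) auto
  finally have "N * ((1 - \<delta>) * N) \<le> N * (sqrt (1 + \<delta>) * (2 * \<epsilon>) + \<delta> * sqrt 2 * (N + 2 * e))"
    by (simp add: algebra_simps power2_eq_square)
  \<comment> \<open>One factor \<open>N\<close> is cancelled; for \<open>N = 0\<close> the left side
    vanishes and the right side is nonnegative.\<close>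
  then have "(1 - \<delta>) * N \<le> sqrt (1 + \<delta>) * (2 * \<epsilon>) + \<delta> * sqrt 2 * (N + 2 * e)"
  proof (cases "N = 0")
    case False
    then show ?thesis using nonneg \<open>N * ((1 - \<delta>) * N) \<le> _\<close> by (simp add: mult_le_cancel_left)
  qed (use \<delta> \<epsilon>0 e0 in simp)
  then have DN: "(1 - (1 + sqrt 2) * \<delta>) * N \<le> 2 * sqrt (1 + \<delta>) * \<epsilon> + 2 * sqrt 2 * \<delta> * e"
    by (simp add: algebra_simps)
  \<comment> \<open>Since \<open>(1 + sqrt 2) * (sqrt 2 - 1) = 1\<close>, positivity is exactly the
    assumed upper bound on \<delta>.\<close>
  have D: "0 < 1 - (1 + sqrt 2) * \<delta>"
  proof -
    have "(1 + sqrt 2) * \<delta> < (1 + sqrt 2) * (sqrt 2 - 1)"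
      using \<delta> by (intro mult_strict_left_mono) (auto simp: add_pos_nonneg)
    then show ?thesis by (simp add: algebra_simps)
  qed
  then have N_le: "N \<le> (2 * sqrt (1 + \<delta>) * \<epsilon> + 2 * sqrt 2 * \<delta> * e) / (1 - (1 + sqrt 2) * \<delta>)"
    using DN by (simp add: pos_le_divide_eq mult.commute)
  \<comment> \<open>The rows outside \<open>W\<close> are handled by \<open>tail\<close> with the
    norm itself as \<open>f\<close> and \<open>c = 1\<close>. This gives \<open>N + \<tau>\<close>,
    and hence \<open>2 * N + 2 * e\<close>.\<close>
  have "mixed_norm 2 2 H \<le> N + mixed_norm 2 2 (keep_rows R H)"
    using mixed_norm_2_2_triangle[of "keep_rows W H" m d "keep_rows R H"] H sub normW
      keep_rows_Un[of W R H] keep_rows_all[OF H] by simp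
  also have "mixed_norm 2 2 (keep_rows R H) \<le> 1 * \<tau>"
  proof (rule tail)
    fix A assume "A \<subseteq> R"
    then show "mixed_norm 2 2 (keep_rows A H) \<le> 1 * L2_set h A"
      using mixed_norm_2_2_keep_rows[OF H, of A] sub by (simp add: h_def)
  qed (simp_all add: keep_rows_Un
      mixed_norm_2_2_triangle[OF keep_rows_carrier keep_rows_carrier, OF H H])
  finally have "mixed_norm 2 2 H \<le> 2 * N + 2 * e" using \<tau> by simp
  also have "\<dots>
      \<le> 2 * ((2 * sqrt (1 + \<delta>) * \<epsilon> + 2 * sqrt 2 * \<delta> * e) / (1 - (1 + sqrt 2) * \<delta>)) + 2 * e"
    using N_le by (intro add_right_mono mult_left_mono) auto
  also have "\<dots> = (4 * sqrt 2 * \<delta> / (1 - (1 + sqrt 2) * \<delta>) + 2) * e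
      + 4 * sqrt (1 + \<delta>) / (1 - (1 + sqrt 2) * \<delta>) * \<epsilon>"
  proof -
    have "2 * ((2 * x * \<epsilon> + 2 * y * \<delta> * e) / z) + 2 * e = (4 * y * \<delta> / z + 2) * e + 4 * x / z * \<epsilon>"
      for x y z :: real
      by (simp add: add_divide_distrib algebra_simps)
    then show ?thesis .
  qed
  finally show ?thesis by (simp add: e_def)
qed

text \<open>The reverse triangle inequality is used in opposite directions: on \<open>S\<close> a
  row of \<open>Z\<close> weighs at least that of \<open>X\<close> minus that of
  \<open>Z - X\<close>, off \<open>S\<close> at least that of \<open>Z - X\<close> minus that of
  \<open>X\<close>. Adding up and comparing with the total weight of \<open>X\<close> leaves twice
  the weight of \<open>X\<close> off \<open>S\<close>.\<close>

lemma minimizer_cone_condition: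
  assumes X: "X \<in> carrier_mat m d" and Z: "Z \<in> carrier_mat m d" and S: "S \<subseteq> {..<m}"
    and le: "mixed_norm 1 2 Z \<le> mixed_norm 1 2 X"
  shows "sum (row_norm (Z - X)) ({..<m} - S)
    \<le> sum (row_norm (Z - X)) S + 2 * mixed_norm 1 2 (X - keep_rows S X)"
proof -
  let ?H = "Z - X"
  have H: "?H \<in> carrier_mat m d" using X by (rule minus_carrier_mat)
  have split: "sum f {..<m} = sum f S + sum f ({..<m} - S)" for f :: "nat \<Rightarrow> real"
    using sum.subset_diff[OF S, of f] by simp
  have rows: "row_norm X i - row_norm ?H i \<le> row_norm Z i"
    "row_norm ?H i - row_norm X i \<le> row_norm Z i" if "i < m" for i
  proof -
    have "X = Z + - ?H" "?H = Z + - X" using X Z by (auto intro!: eq_matI)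
    then have "row_norm X i \<le> row_norm Z i + row_norm (- ?H) i"
      "row_norm ?H i \<le> row_norm Z i + row_norm (- X) i"
      using row_norm_triangle[of Z m d "- ?H" i] row_norm_triangle[of Z m d "- X" i] X Z H that
      by (metis uminus_carrier_mat)+
    then show "row_norm X i - row_norm ?H i \<le> row_norm Z i"
      "row_norm ?H i - row_norm X i \<le> row_norm Z i"
      using row_norm_uminus[OF H that] row_norm_uminus[OF X that] by simp_all
  qed
  have "X - keep_rows S X = keep_rows ({..<m} - S) X"
    using X by (intro eq_matI) (auto simp: keep_rows_def)
  then have "mixed_norm 1 2 (X - keep_rows S X) = (\<Sum>i<m. row_norm (keep_rows ({..<m} - S) X) i)"
    using keep_rows_carrier[OF X, of "{..<m} - S"] by (simp only: mixed_norm_1_2 carrier_matD)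
  also have "\<dots> = sum (row_norm X) ({..<m} - S)"
    unfolding split using S X by (auto simp: row_norm_keep_rows intro!: sum.neutral)
  finally have \<sigma>: "mixed_norm 1 2 (X - keep_rows S X) = sum (row_norm X) ({..<m} - S)" .
  have "sum (row_norm X) S - sum (row_norm ?H) S \<le> sum (row_norm Z) S"
    unfolding sum_subtractf[symmetric] using rows S by (intro sum_mono) auto
  moreover have "sum (row_norm ?H) ({..<m} - S) - sum (row_norm X) ({..<m} - S)
      \<le> sum (row_norm Z) ({..<m} - S)"
    unfolding sum_subtractf[symmetric] using rows by (intro sum_mono) auto
  moreover have "sum (row_norm Z) {..<m} \<le> sum (row_norm X) {..<m}"
    using le X Z by (simp add: mixed_norm_1_2)
  ultimately show ?thesis using \<sigma> split[of "row_norm Z"] split[of "row_norm X"] by linarith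
qed

theorem theorem1:
  shows "\<exists>C\<^sub>1 C\<^sub>2 :: real \<Rightarrow> real.
    \<forall>(n::nat) (m::nat) (d::nat) (s::nat) (p::nat) (q::nat) (\<Phi> :: nat \<Rightarrow> complex mat)
      (\<phi> :: complex mat \<Rightarrow> complex mat) (L :: complex mat \<Rightarrow> complex mat)
      (X :: complex mat) (Xs :: complex mat) (E :: complex mat) (Y :: complex mat)
      (\<epsilon> :: real) (\<delta> :: real) (Xhat :: complex mat).
      1 \<le> n \<and> 1 \<le> m \<and> 1 \<le> d \<and> 1 \<le> s \<and>
      (\<forall>j<d. \<Phi> j \<in> carrier_mat n m \<and> (\<forall>k<m. lp_norm 2 (col (\<Phi> j) k) = 1)) \<and>
      \<phi> = columnwise_map n d \<Phi> \<and>
      linear_map class_ring (module_mat TYPE(complex) m d) (module_mat TYPE(complex) p q) L \<and>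
      X \<in> carrier_mat m d \<and> L X = 0\<^sub>m p q \<and>
      is_best_row_approx s X Xs \<and>
      E \<in> carrier_mat n d \<and>
      Y = \<phi> X + E \<and> \<epsilon> = mixed_norm 2 2 E \<and>
      row_sparse_RIP m d \<phi> (2 * s) \<delta> \<and> \<delta> < sqrt 2 - 1 \<and>
      is_arg_min (mixed_norm 1 2)
        (\<lambda>Z. Z \<in> carrier_mat m d \<and> mixed_norm 2 2 (Y - \<phi> Z) \<le> \<epsilon> \<and> L Z = 0\<^sub>m p q) Xhat
      \<longrightarrow> mixed_norm 2 2 (Xhat - X)
            \<le> C\<^sub>1 \<delta> * real s powr (-1/2) * mixed_norm 1 2 (X - Xs) + C\<^sub>2 \<delta> * \<epsilon>"
\<comment> \<open>The constants are those of \<open>recovery_bound\<close>: functions of \<delta>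
  alone, with positive denominator for \<open>\<delta> < sqrt 2 - 1\<close>.\<close>
proof (rule exI[of _ "\<lambda>\<delta>. 4 * sqrt 2 * \<delta> / (1 - (1 + sqrt 2) * \<delta>) + 2"],
    rule exI[of _ "\<lambda>\<delta>. 4 * sqrt (1 + \<delta>) / (1 - (1 + sqrt 2) * \<delta>)"],
    intro allI impI, elim conjE)
  fix n m d s p q :: nat and \<Phi> :: "nat \<Rightarrow> complex mat" and \<phi> L :: "complex mat \<Rightarrow> complex mat"
    and X Xs E Y Xhat :: "complex mat" and \<epsilon> \<delta> :: real
  assume md: "1 \<le> m" "1 \<le> d" and s: "1 \<le> s"
    and \<Phi>: "\<forall>j<d. \<Phi> j \<in> carrier_mat n m \<and> (\<forall>k<m. lp_norm 2 (col (\<Phi> j) k) = 1)"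
    and \<phi>: "\<phi> = columnwise_map n d \<Phi>"
    and X: "X \<in> carrier_mat m d" and LX: "L X = 0\<^sub>m p q"
    and Xs: "is_best_row_approx s X Xs"
    and E: "E \<in> carrier_mat n d" and Y: "Y = \<phi> X + E" and \<epsilon>: "\<epsilon> = mixed_norm 2 2 E"
    and RIP: "row_sparse_RIP m d \<phi> (2 * s) \<delta>" and \<delta>: "\<delta> < sqrt 2 - 1"
    and min: "is_arg_min (mixed_norm 1 2)
      (\<lambda>Z. Z \<in> carrier_mat m d \<and> mixed_norm 2 2 (Y - \<phi> Z) \<le> \<epsilon> \<and> L Z = 0\<^sub>m p q) Xhat"
  have \<Phi>': "\<forall>j<d. \<Phi> j \<in> carrier_mat n m" using \<Phi> by blast
  obtain S where S: "S \<subseteq> {..<m}" "card S \<le> s" "Xs = keep_rows S X"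
    using Xs X unfolding is_best_row_approx_def by auto
  have car: "\<phi> Z \<in> carrier_mat n d" for Z by (simp add: \<phi>)
  \<comment> \<open>The residual of \<open>X\<close> is exactly the noise, so \<open>X\<close>
    itself competes in the minimization.\<close>
  have "Y - \<phi> X = E"
    using E car[of X] by (intro eq_matI) (auto simp: Y)
  then have feas: "mixed_norm 2 2 (Y - \<phi> X) \<le> \<epsilon>" by (simp add: \<epsilon>)
  have Xhat: "Xhat \<in> carrier_mat m d" "mixed_norm 2 2 (Y - \<phi> Xhat) \<le> \<epsilon>"
    using min by (auto simp: is_arg_min_def)
  have le: "mixed_norm 1 2 Xhat \<le> mixed_norm 1 2 X"
    using min X feas LX unfolding is_arg_min_def by (metis not_less)
  define H where "H = Xhat - X"
  have H: "H \<in> carrier_mat m d" unfolding H_def using X by (rule minus_carrier_mat)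
  have "Xhat = X + H" using X Xhat by (intro eq_matI) (auto simp: H_def)
  then have "\<phi> Xhat = \<phi> X + \<phi> H"
    using columnwise_map_add[OF X H \<Phi>'] by (simp add: \<phi>)
  \<comment> \<open>The tube condition: \<open>\<phi> H\<close> is the difference of the residuals
    of \<open>X\<close> and \<open>Xhat\<close>, each of norm at most \<epsilon>.\<close>
  then have "\<phi> H = E + - (Y - \<phi> Xhat)"
    using E car[of X] car[of H] by (intro eq_matI) (auto simp: Y)
  then have "mixed_norm 2 2 (\<phi> H) \<le> 2 * \<epsilon>"
    using mixed_norm_2_2_triangle[of E n d "- (Y - \<phi> Xhat)"] E minus_carrier_mat[OF car] Xhat(2)
    by (simp add: \<epsilon> mixed_norm_2_2_uminus)
  moreover have "0 \<le> \<delta>" by (rule row_sparse_RIP_nonneg[OF RIP]) (use md s in auto)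
  moreover have "0 \<le> mixed_norm 1 2 (X - Xs)" by (simp add: mixed_norm_1_2 sum_nonneg)
  moreover have "real s powr (- 1 / 2) = 1 / sqrt (real s)"
    by (simp add: powr_minus_divide powr_half_sqrt)
  ultimately show "mixed_norm 2 2 (Xhat - X)
      \<le> (4 * sqrt 2 * \<delta> / (1 - (1 + sqrt 2) * \<delta>) + 2) * real s powr (- 1 / 2)
          * mixed_norm 1 2 (X - Xs)
        + 4 * sqrt (1 + \<delta>) / (1 - (1 + sqrt 2) * \<delta>) * \<epsilon>"
    using recovery_bound[OF \<phi> \<Phi>' RIP H s _ \<delta> S(1,2) _ _]
      minimizer_cone_condition[OF X Xhat(1) S(1) le]
    by (simp add: H_def S(3))
qed

end
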